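(* Let $x^{(2)},x^{(3)},\dots$ be the points generated by the subspace framework (Algorithm SF, described in the context). If two of these points $x^{(\ell)},x^{(k)}$ with $2\le\ell<k$ are equal, then $x^{(\ell)}$ is a global minimizer of $\alpha_\epsilon(x)$ over all $x\in\underline{\Omega}$.
   Context: Let $\Omega\subseteq\mathbb{R}^d$ be nonempty and open, $\underline{\Omega}\subseteq\Omega$ compact and convex with nonempty interior, $f_1,\dots,f_\kappa:\Omega\to\mathbb{R}$ real-analytic, $A_1,\dots,A_\kappa\in\mathbb{C}^{n\times n}$, $A(x)=\sum_{j=1}^{\kappa}f_j(x)A_j$, and $\epsilon>0$. $\sigma_{\min}$ is the smallest singular value (for an $n\times k$ matrix with $k\le n$, the smallest of its $k$ singular values). $\Lambda_\epsilon(x)=\{z\in\mathbb{C}:\sigma_{\min}(A(x)-zI)\le\epsilon\}$ and $\alpha_\epsilon(x)=\max\{\mathrm{Re}(z):z\in\Lambda_\epsilon(x)\}$. For a subspace $\mathcal{V}\subseteq\mathbb{C}^n$ and a matrix $V$ whose columns form an orthonormal basis of $\mathcal{V}$, $A^V(x)=A(x)V$, $\Lambda^{\mathcal{V}}_\epsilon(x)=\{z\in\mathbb{C}:\sigma_{\min}(A^V(x)-zV)\le\epsilon\}$ (independent of the choice of $V$) and, if this set is nonempty, $\alpha^{\mathcal{V}}_\epsilon(x)=\max\{\mathrm{Re}(z):z\in\Lambda^{\mathcal{V}}_\epsilon(x)\}$. A rightmost point of either set is a point of it with maximal real part. Algorithm SF: choose points $x^{(1)}_1,\dots,x^{(1)}_\eta\in\underline{\Omega}$;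 for each $j$ let $z^{(1)}_j$ be a rightmost point of $\Lambda_\epsilon(x^{(1)}_j)$ and $v^{(1)}_j$ a right singular vector corresponding to $\sigma_{\min}(A(x^{(1)}_j)-z^{(1)}_jI)$; set $\mathcal{V}_1=\mathrm{span}\{v^{(1)}_1,\dots,v^{(1)}_\eta\}$. For $k=2,3,\dots$: let $x^{(k)}$ be any global minimizer of $\alpha^{\mathcal{V}_{k-1}}_\epsilon$ over $\underline{\Omega}$; let $z^{(k)}$ be any rightmost point of $\Lambda_\epsilon(x^{(k)})$; let $v^{(k)}$ be a unit right singular vector corresponding to $\sigma_{\min}(A(x^{(k)})-z^{(k)}I)$; set $\mathcal{V}_k=\mathcal{V}_{k-1}+\mathrm{span}\{v^{(k)}\}$. Standing assumption: $\Lambda^{\mathcal{V}_1}_\epsilon(x)\neq\emptyset$ for all $x\in\underline{\Omega}$ (which implies $\Lambda^{\mathcal{V}_k}_\epsilon(x)\neq\emptyset$ for all $x\in\underline{\Omega}$ and all $k$). *)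

theory Defs
  imports "HOL-Analysis.Analysis" "Jordan_Normal_Form.Schur_Decomposition"
begin

text \<open>
  Complex matrices and vectors are those of Jordan-Normal-Form, because the number of columns of a
  basis matrix of a subspace varies; the parameter space is the type \<open>real ^ 'd\<close>.
  Names shared with HOL-Analysis are qualified with \<open>Matrix\<close>.
\<close>

text \<open>The multi-indices are the functions \<open>m :: 'd \<Rightarrow> nat\<close>; \<open>has_sum\<close> is unconditional summation,
  so the expansion converges absolutely.\<close>

definition real_analytic_on :: "(real ^ 'd \<Rightarrow> real) \<Rightarrow> (real ^ 'd) set \<Rightarrow> bool" where
  "real_analytic_on f S \<longleftrightarrow>
     (\<forall>a\<in>S. \<exists>r>0. \<exists>c :: ('d \<Rightarrow> nat) \<Rightarrow> real. ball a r \<subseteq> S \<and>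
        (\<forall>x\<in>ball a r.
           ((\<lambda>m. c m * (\<Prod>i\<in>UNIV. (vec_nth x i - vec_nth a i) ^ m i)) has_sum f x) UNIV))"

text \<open>For an \<open>n \<times> k\<close> matrix with \<open>k \<le> n\<close>, the \<open>k \<times> k\<close> matrix \<open>M\<^sup>* M\<close> accounts for all \<open>k\<close> singular
  values; for \<open>k > n\<close> the values below would include extra zeros.\<close>

definition singular_value :: "complex Matrix.mat \<Rightarrow> real \<Rightarrow> bool" where
  "singular_value M s \<longleftrightarrow> 0 \<le> s \<and> eigenvalue (mat_adjoint M * M) (complex_of_real (s\<^sup>2))"

definition right_singular_vector :: "complex Matrix.mat \<Rightarrow> real \<Rightarrow> complex Matrix.vec \<Rightarrow> bool" where
  "right_singular_vector M s v \<longleftrightarrow>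
     singular_value M s \<and> eigenvector (mat_adjoint M * M) v (complex_of_real (s\<^sup>2))"

definition sigma_min :: "complex Matrix.mat \<Rightarrow> real" where
  "sigma_min M = Min {s. singular_value M s}"

definition rightmost :: "complex set \<Rightarrow> complex \<Rightarrow> bool" where
  "rightmost S z \<longleftrightarrow> is_arg_max Re (\<lambda>w. w \<in> S) z"

text \<open>\<open>Max\<close> is only meaningful for finite sets, hence \<open>GREATEST\<close>.\<close>

definition abscissa :: "complex set \<Rightarrow> real" where
  "abscissa S = (GREATEST r. r \<in> Re ` S)"

definition matrix_family ::
    "nat \<Rightarrow> nat \<Rightarrow> (nat \<Rightarrow> 'x \<Rightarrow> real) \<Rightarrow> (nat \<Rightarrow> complex Matrix.mat) \<Rightarrow> 'x \<Rightarrow> complex Matrix.mat" where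
  "matrix_family n \<kappa> f A x =
     Matrix.mat n n (\<lambda>(i, j). \<Sum>l=1..\<kappa>. complex_of_real (f l x) * A l $$ (i, j))"

definition pseudospectrum :: "nat \<Rightarrow> real \<Rightarrow> complex Matrix.mat \<Rightarrow> complex set" where
  "pseudospectrum n \<epsilon> B = {z. sigma_min (B - z \<cdot>\<^sub>m 1\<^sub>m n) \<le> \<epsilon>}"

abbreviation cspan :: "nat \<Rightarrow> complex Matrix.vec set \<Rightarrow> complex Matrix.vec set" where
  "cspan n \<equiv> LinearCombinations.module.span class_ring (module_vec TYPE(complex) n)"

definition orthonormal_basis_mat :: "nat \<Rightarrow> complex Matrix.vec set \<Rightarrow> complex Matrix.mat \<Rightarrow> bool" where
  "orthonormal_basis_mat n W V \<longleftrightarrow>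
     (\<exists>m. V \<in> carrier_mat n m \<and> mat_adjoint V * V = 1\<^sub>m m \<and> cspan n (set (cols V)) = W)"

text \<open>The reduced pseudospectrum does not depend on which orthonormal basis is selected: two of them
  differ by a unitary factor on the right, which does not change singular values.\<close>

definition reduced_pseudospectrum ::
    "nat \<Rightarrow> real \<Rightarrow> complex Matrix.vec set \<Rightarrow> complex Matrix.mat \<Rightarrow> complex set" where
  "reduced_pseudospectrum n \<epsilon> W B =
     (let V = (SOME V. orthonormal_basis_mat n W V)
      in {z. sigma_min (B * V - z \<cdot>\<^sub>m V) \<le> \<epsilon>})"

text \<open>Runs of the subspace framework for the family \<open>B\<close>, the tolerance \<open>\<epsilon>\<close> and the parameter domain
  \<open>K\<close>. The points \<open>x1 j, z1 j, v1 j\<close> with \<open>1 \<le> j \<le> \<eta>\<close> are those of the first step, and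
  \<open>x k, z k, v k\<close> with \<open>k \<ge> 2\<close> those of the later ones; \<open>W k\<close> with \<open>k \<ge> 1\<close> is the subspace after
  step \<open>k\<close>. Values at other indices are irrelevant.\<close>

definition subspace_framework ::
    "nat \<Rightarrow> real \<Rightarrow> ('x \<Rightarrow> complex Matrix.mat) \<Rightarrow> 'x set \<Rightarrow>
     nat \<Rightarrow> (nat \<Rightarrow> 'x) \<Rightarrow> (nat \<Rightarrow> complex) \<Rightarrow> (nat \<Rightarrow> complex Matrix.vec) \<Rightarrow>
     (nat \<Rightarrow> 'x) \<Rightarrow> (nat \<Rightarrow> complex) \<Rightarrow> (nat \<Rightarrow> complex Matrix.vec) \<Rightarrow>
     (nat \<Rightarrow> complex Matrix.vec set) \<Rightarrow> bool" where
  "subspace_framework n \<epsilon> B K \<eta> x1 z1 v1 x z v W \<longleftrightarrow>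
     (\<forall>j\<in>{1..\<eta>}. x1 j \<in> K \<and>
        rightmost (pseudospectrum n \<epsilon> (B (x1 j))) (z1 j) \<and>
        right_singular_vector (B (x1 j) - z1 j \<cdot>\<^sub>m 1\<^sub>m n)
          (sigma_min (B (x1 j) - z1 j \<cdot>\<^sub>m 1\<^sub>m n)) (v1 j)) \<and>
     W 1 = cspan n (v1 ` {1..\<eta>}) \<and>
     (\<forall>k\<ge>2.
        is_arg_min (\<lambda>y. abscissa (reduced_pseudospectrum n \<epsilon> (W (k - 1)) (B y))) (\<lambda>y. y \<in> K) (x k) \<and>
        rightmost (pseudospectrum n \<epsilon> (B (x k))) (z k) \<and>
        right_singular_vector (B (x k) - z k \<cdot>\<^sub>m 1\<^sub>m n)
          (sigma_min (B (x k) - z k \<cdot>\<^sub>m 1\<^sub>m n)) (v k) \<and>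
        v k \<bullet>c v k = 1 \<and>
        W k = {a + b | a b. a \<in> W (k - 1) \<and> b \<in> cspan n {v k}})"

end

theory Submission
  imports Defs "Jordan_Normal_Form.Spectral_Radius"
begin

text \<open>
  A point \<open>z\<close> lies in the reduced pseudospectrum of \<open>B\<close> for the subspace \<open>W\<close> iff some nonzero
  \<open>w \<in> W\<close> satisfies \<open>\<parallel>Bw - zw\<parallel> \<le> \<epsilon>\<parallel>w\<parallel>\<close>, so reduced pseudospectra grow with \<open>W\<close> and stay inside the
  full one. The subspace \<open>W (k - 1)\<close> contains the singular vector \<open>v l\<close>, hence its abscissa agrees
  with the full one at \<open>x l\<close>. As \<open>x l = x k\<close> minimizes the former, which is nowhere larger than the
  latter, \<open>x l\<close> minimizes the latter.
\<close>

unbundle no vec_syntax and no inner_syntax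

section \<open>Norms and adjoints\<close>

definition vec_norm :: "complex Matrix.vec \<Rightarrow> real" where
  "vec_norm v = L2_set (\<lambda>i. cmod (v $ i)) {..<dim_vec v}"

lemma cscalar_prod_sum:
  fixes v w :: "complex Matrix.vec"
  assumes "v \<in> carrier_vec n" "w \<in> carrier_vec n"
  shows "v \<bullet>c w = (\<Sum>i<n. v $ i * cnj (w $ i))"
  using assms by (auto simp: scalar_prod_def atLeast0LessThan intro!: sum.cong)

lemma vec_norm_sq:
  assumes "v \<in> carrier_vec n"
  shows "(vec_norm v)\<^sup>2 = (\<Sum>i<n. (cmod (v $ i))\<^sup>2)"
  using assms by (auto simp: vec_norm_def L2_set_def sum_nonneg)

lemma cscalar_prod_self: "v \<bullet>c v = complex_of_real ((vec_norm v)\<^sup>2)" for v :: "complex Matrix.vec"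
  by (simp add: cscalar_prod_sum[OF carrier_vec_dim_vec carrier_vec_dim_vec]
      vec_norm_sq[OF carrier_vec_dim_vec] complex_norm_square del: of_real_power)

lemma vec_norm_nonneg [simp]: "0 \<le> vec_norm v"
  by (simp add: vec_norm_def)

lemma vec_norm_eq_0_iff: "v \<in> carrier_vec n \<Longrightarrow> vec_norm v = 0 \<longleftrightarrow> v = 0\<^sub>v n"
  by (auto simp: vec_norm_def L2_set_eq_0_iff)

lemma vec_norm_smult: "vec_norm (a \<cdot>\<^sub>v v) = cmod a * vec_norm v"
  by (auto simp: vec_norm_def L2_set_right_distrib norm_mult intro!: L2_set_cong)

lemma vec_norm_triangle:
  assumes "v \<in> carrier_vec n" "w \<in> carrier_vec n"
  shows "vec_norm (v + w) \<le> vec_norm v + vec_norm w"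
proof -
  have "vec_norm (v + w) \<le> L2_set (\<lambda>i. cmod (v $ i) + cmod (w $ i)) {..<n}"
    using assms by (auto simp: vec_norm_def intro!: L2_set_mono norm_triangle_ineq)
  also have "\<dots> \<le> vec_norm v + vec_norm w"
    using assms L2_set_triangle_ineq by (auto simp: vec_norm_def)
  finally show ?thesis .
qed

text \<open>Because \<open>t\<close> is real, the two cross terms are complex conjugates and add up
  to twice a real part. The result is a real quadratic in \<open>t\<close>, the form needed for a
  first-order condition at a minimizer.\<close>

lemma vec_norm_add_smult_sq:
  assumes v: "v \<in> carrier_vec n" and w: "w \<in> carrier_vec n"
  shows "(vec_norm (v + complex_of_real t \<cdot>\<^sub>v w))\<^sup>2
    = (vec_norm v)\<^sup>2 + 2 * t * Re (v \<bullet>c w) + t\<^sup>2 * (vec_norm w)\<^sup>2"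
proof -
  have "v + complex_of_real t \<cdot>\<^sub>v w \<in> carrier_vec n"
    using v w by simp
  from vec_norm_sq[OF this] have "(vec_norm (v + complex_of_real t \<cdot>\<^sub>v w))\<^sup>2 =
      (\<Sum>i<n. (cmod (v $ i + complex_of_real t * w $ i))\<^sup>2)"
    using v w by simp
  also have "\<dots> = (\<Sum>i<n. (cmod (v $ i))\<^sup>2 + 2 * t * Re (v $ i * cnj (w $ i)) + t\<^sup>2 * (cmod (w $ i))\<^sup>2)"
    by (intro sum.cong refl) (simp only: cmod_power2, simp add: power2_eq_square algebra_simps)
  finally show ?thesis
    using v w by (simp add: vec_norm_sq cscalar_prod_sum[OF v w] sum.distrib sum_distrib_left distrib_left)
qed

section \<open>Adjoints, isometries and singular vectors\<close>

lemma mat_adjoint_carrier: "M \<in> carrier_mat n m \<Longrightarrow> mat_adjoint M \<in> carrier_mat m n"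
  by (intro carrier_matI) (simp_all add: mat_adjoint_def)

lemma index_mat_adjoint:
  fixes M :: "complex Matrix.mat"
  assumes "M \<in> carrier_mat n m" "i < m" "j < n"
  shows "mat_adjoint M $$ (i, j) = cnj (M $$ (j, i))"
  using assms by (auto simp: mat_adjoint_def mat_of_rows_index)

text \<open>\<open>\<bullet>c\<close> conjugates its second argument, so the entries of
  \<open>M\<close> pass to the left factor conjugated, which is the action of
  \<open>mat_adjoint M\<close>; the rest is an interchange of two finite sums.\<close>

lemma cscalar_prod_mult_mat_vec:
  fixes M :: "complex Matrix.mat"
  assumes M: "M \<in> carrier_mat n m" and v: "v \<in> carrier_vec n" and w: "w \<in> carrier_vec m"
  shows "v \<bullet>c (M *\<^sub>v w) = (mat_adjoint M *\<^sub>v v) \<bullet>c w"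
proof -
  have "v \<bullet>c (M *\<^sub>v w) = (\<Sum>j<n. \<Sum>i<m. v $ j * cnj (M $$ (j, i)) * cnj (w $ i))"
    using M v w by (subst cscalar_prod_sum[OF v, of _])
     (auto simp: scalar_prod_def atLeast0LessThan sum_distrib_left mult.assoc intro!: sum.cong)
  also have "\<dots> = (\<Sum>i<m. \<Sum>j<n. v $ j * cnj (M $$ (j, i)) * cnj (w $ i))"
    by (rule sum.swap)
  also have "\<dots> = (mat_adjoint M *\<^sub>v v) \<bullet>c w"
    unfolding cscalar_prod_sum[OF mult_mat_vec_carrier[OF mat_adjoint_carrier[OF M] v] w]
    using v mat_adjoint_carrier[OF M]
    by (intro sum.cong refl)
      (simp add: scalar_prod_def atLeast0LessThan sum_distrib_left sum_distrib_right
          index_mat_adjoint[OF M] ac_simps)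
  finally show ?thesis .
qed

lemma vec_norm_mult_mat_vec_sq:
  assumes M: "M \<in> carrier_mat n m" and c: "c \<in> carrier_vec m"
  shows "complex_of_real ((vec_norm (M *\<^sub>v c))\<^sup>2) = ((mat_adjoint M * M) *\<^sub>v c) \<bullet>c c"
  using assoc_mult_mat_vec[OF mat_adjoint_carrier[OF M] M c]
    cscalar_prod_mult_mat_vec[OF M mult_mat_vec_carrier[OF M c] c]
  by (simp only: cscalar_prod_self)

text \<open>The Gram matrix in \<open>vec_norm_mult_mat_vec_sq\<close> is the identity here.
  Coordinates \<open>c\<close> and vectors \<open>V *\<^sub>v c\<close> of the subspace can thus be
  exchanged in norm estimates.\<close>

lemma vec_norm_isometry:
  assumes V: "V \<in> carrier_mat n m" and VV: "mat_adjoint V * V = 1\<^sub>m m" and c: "c \<in> carrier_vec m"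
  shows "vec_norm (V *\<^sub>v c) = vec_norm c"
proof -
  have "(vec_norm (V *\<^sub>v c))\<^sup>2 = (vec_norm c)\<^sup>2"
    using vec_norm_mult_mat_vec_sq[OF V c] c unfolding VV
    by (simp add: cscalar_prod_self del: of_real_power)
  then show ?thesis
    by simp
qed

text \<open>Pairing the eigenvalue equation with \<open>v\<close> equates the squares of both sides
  of the last claim; the root may be taken because \<open>s\<close> is nonnegative.\<close>

lemma right_singular_vector_norm:
  assumes M: "M \<in> carrier_mat n m" and v: "eigenvector (mat_adjoint M * M) v (complex_of_real (s\<^sup>2))"
    and s: "0 \<le> s"
  shows "v \<in> carrier_vec m" "vec_norm v > 0" "vec_norm (M *\<^sub>v v) = s * vec_norm v"
proof -
  from v M show vc: "v \<in> carrier_vec m"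
    by (auto simp: eigenvector_def mat_adjoint_def)
  have ev: "(mat_adjoint M * M) *\<^sub>v v = complex_of_real (s\<^sup>2) \<cdot>\<^sub>v v" and "v \<noteq> 0\<^sub>v m"
    using v M by (auto simp: eigenvector_def mat_adjoint_def)
  then show "vec_norm v > 0"
    using vec_norm_eq_0_iff[OF vc] vec_norm_nonneg[of v] by linarith
  have "complex_of_real ((vec_norm (M *\<^sub>v v))\<^sup>2) = complex_of_real ((s * vec_norm v)\<^sup>2)"
    using vc unfolding vec_norm_mult_mat_vec_sq[OF M vc] ev
    by (simp add: cscalar_prod_self power_mult_distrib)
  then have "(vec_norm (M *\<^sub>v v))\<^sup>2 = (s * vec_norm v)\<^sup>2"
    using of_real_eq_iff by blast
  then show "vec_norm (M *\<^sub>v v) = s * vec_norm v"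
    using s by simp
qed

section \<open>Smallest singular values\<close>

text \<open>Vectors of the matrix library carry no topology, hence the sphere of finitely supported functions
  in the product topology.\<close>

lemma compact_unit_sphere_fun:
  "compact {c :: nat \<Rightarrow> complex. (\<forall>i\<ge>m. c i = 0) \<and> (\<Sum>i<m. (cmod (c i))\<^sup>2) = 1}" (is "compact ?S")
proof -
  let ?B = "PiE UNIV (\<lambda>i. if i < m then cball 0 1 else {0}) :: (nat \<Rightarrow> complex) set"
  have "compactin (product_topology (\<lambda>i. euclidean) UNIV) ?B"
    by (subst compactin_PiE) auto
  then have "compact ?B"
    by (simp add: euclidean_product_topology)
  moreover have "closed {c :: nat \<Rightarrow> complex. (\<Sum>i<m. (cmod (c i))\<^sup>2) = 1}"
    by (intro closed_Collect_eq continuous_intros continuous_on_product_coordinates)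
  ultimately have "compact (?B \<inter> {c. (\<Sum>i<m. (cmod (c i))\<^sup>2) = 1})"
    by (rule compact_Int_closed)
  moreover have "?B \<inter> {c. (\<Sum>i<m. (cmod (c i))\<^sup>2) = 1} = ?S"
  proof -
    have "cmod (c i) \<le> 1" if "(\<Sum>i<m. (cmod (c i))\<^sup>2) = 1" "i < m" for c :: "nat \<Rightarrow> complex" and i
    proof -
      have "(cmod (c i))\<^sup>2 \<le> (\<Sum>i<m. (cmod (c i))\<^sup>2)"
        using that by (intro member_le_sum) auto
      then show ?thesis
        using that by (simp add: power_le_one_iff)
    qed
    then show ?thesis
      by (auto simp: PiE_UNIV_domain Pi_iff split: if_splits)
  qed
  ultimately show ?thesis
    by simp
qed

text \<open>A continuous function attains its minimum on the compact unit sphere, which is nonempty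
  as \<open>m > 0\<close>; homogeneity extends the inequality from unit vectors to all
  \<open>d\<close>.\<close>

lemma min_vec_norm_mult_mat_vec:
  assumes M: "M \<in> carrier_mat n m" and m: "m > 0"
  obtains c where "c \<in> carrier_vec m" "vec_norm c = 1"
    "\<And>d. d \<in> carrier_vec m \<Longrightarrow> vec_norm (M *\<^sub>v c) * vec_norm d \<le> vec_norm (M *\<^sub>v d)"
proof -
  define S where "S = {c :: nat \<Rightarrow> complex. (\<forall>i\<ge>m. c i = 0) \<and> (\<Sum>i<m. (cmod (c i))\<^sup>2) = 1}"
  let ?h = "\<lambda>c :: nat \<Rightarrow> complex. \<Sum>j<n. (cmod (\<Sum>i<m. M $$ (j, i) * c i))\<^sup>2"
  have h: "?h c = (vec_norm (M *\<^sub>v Matrix.vec m c))\<^sup>2" for c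
  proof -
    have "M *\<^sub>v Matrix.vec m c \<in> carrier_vec n"
      using M by simp
    from vec_norm_sq[OF this] show ?thesis
      using M by (auto simp: scalar_prod_def atLeast0LessThan intro!: sum.cong)
  qed
  let ?e0 = "\<lambda>i :: nat. if i = 0 then 1 else 0 :: complex"
  have "(\<Sum>i<m. (cmod (?e0 i))\<^sup>2) = (\<Sum>i<m. if i = 0 then 1 else 0)"
    by (intro sum.cong) auto
  then have "?e0 \<in> S"
    using m by (simp add: S_def)
  then have ne: "S \<noteq> {}"
    by blast
  have "continuous_on S ?h"
    by (intro continuous_intros continuous_on_subset[OF continuous_on_product_coordinates]) auto
  from continuous_attains_inf[OF compact_unit_sphere_fun[of m, folded S_def] ne this]
  obtain c0 where c0: "c0 \<in> S" "\<And>d. d \<in> S \<Longrightarrow> ?h c0 \<le> ?h d"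
    by blast
  let ?c = "Matrix.vec m c0"
  have "(vec_norm ?c)\<^sup>2 = 1"
    using c0(1) by (simp add: S_def vec_norm_sq[of _ m])
  then have nc: "vec_norm ?c = 1"
    by (simp add: power2_eq_1_iff) (smt (verit) vec_norm_nonneg)
  have "vec_norm (M *\<^sub>v ?c) * vec_norm d \<le> vec_norm (M *\<^sub>v d)" if d: "d \<in> carrier_vec m" for d
  proof (cases "vec_norm d = 0")
    case False
    define e where "e = complex_of_real (inverse (vec_norm d)) \<cdot>\<^sub>v d"
    have e: "e \<in> carrier_vec m" "vec_norm e = 1"
      using False d by (auto simp: e_def vec_norm_smult norm_inverse)
    have Me: "vec_norm (M *\<^sub>v e) = inverse (vec_norm d) * vec_norm (M *\<^sub>v d)"
      using M d by (simp add: e_def mult_mat_vec[OF M d] vec_norm_smult norm_inverse)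
    \<comment> \<open>Padding with zeros puts the unit vector among the functions that encode the
      sphere; the first \<open>m\<close> values recover \<open>e\<close>.\<close>
    let ?e = "\<lambda>i. if i < m then e $ i else 0"
    have ve: "Matrix.vec m ?e = e"
      using e by auto
    have "?e \<in> S"
      using e vec_norm_sq[OF e(1)] by (simp add: S_def)
    from c0(2)[OF this] have "(vec_norm (M *\<^sub>v ?c))\<^sup>2 \<le> (vec_norm (M *\<^sub>v e))\<^sup>2"
      unfolding h ve .
    then have "vec_norm (M *\<^sub>v ?c) \<le> vec_norm (M *\<^sub>v e)"
      using power2_le_imp_le vec_norm_nonneg by blast
    then show ?thesis
      using False vec_norm_nonneg[of d] by (simp add: Me field_simps)
  qed simp
  with nc that[of ?c] show ?thesis
    by simp
qed

text \<open>For small \<open>t\<close> of sign opposite to \<open>b\<close>, a nonzero linear term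
  would dominate the quadratic one, whatever the sign of \<open>q\<close>.\<close>

lemma quadratic_nonneg_imp_linear_zero:
  fixes b q :: real
  assumes "\<And>t. 0 \<le> 2 * t * b + t\<^sup>2 * q"
  shows "b = 0"
proof (rule ccontr)
  assume b: "b \<noteq> 0"
  \<comment> \<open>With this \<open>t\<close> the linear term equals -2 (|q| + 1) t^2, which
    outweighs q t^2; the added 1 keeps the denominator positive.\<close>
  define t where "t = - b / (\<bar>q\<bar> + 1)"
  have "b = - (t * (\<bar>q\<bar> + 1))"
    by (simp add: t_def)
  then have "2 * t * b + t\<^sup>2 * q = 2 * t * (- (t * (\<bar>q\<bar> + 1))) + t\<^sup>2 * q"
    by (rule arg_cong)
  also have "\<dots> = t\<^sup>2 * (q - 2 * (\<bar>q\<bar> + 1))"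
    by (simp add: power2_eq_square algebra_simps)
  finally have "2 * t * b + t\<^sup>2 * q = t\<^sup>2 * (q - 2 * (\<bar>q\<bar> + 1))" .
  moreover have "t \<noteq> 0"
    using b by (simp add: t_def)
  ultimately have "2 * t * b + t\<^sup>2 * q < 0"
    by (simp add: mult_less_0_iff abs_if)
  with assms[of t] show False
    by simp
qed

text \<open>At a minimizer \<open>c\<close> of \<open>\<parallel>Md\<parallel>\<^sup>2 - s\<^sup>2\<parallel>d\<parallel>\<^sup>2 \<ge> 0\<close>, the first-order term in direction
  \<open>w = M\<^sup>*Mc - s\<^sup>2c\<close> is \<open>2\<parallel>w\<parallel>\<^sup>2\<close>, so \<open>w\<close> vanishes. This yields the minimality property of
  \<open>sigma_min\<close> without the spectral theorem.\<close>

lemma minimizer_singular_value: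
  assumes M: "M \<in> carrier_mat n m" and c: "c \<in> carrier_vec m" "vec_norm c = 1"
    and min: "\<And>d. d \<in> carrier_vec m \<Longrightarrow> vec_norm (M *\<^sub>v c) * vec_norm d \<le> vec_norm (M *\<^sub>v d)"
  shows "singular_value M (vec_norm (M *\<^sub>v c))"
proof -
  define s where "s = vec_norm (M *\<^sub>v c)"
  define u where "u = (mat_adjoint M * M) *\<^sub>v c"
  define w where "w = u + complex_of_real (- (s\<^sup>2)) \<cdot>\<^sub>v c"
  have u: "u \<in> carrier_vec m"
    unfolding u_def using mult_carrier_mat[OF mat_adjoint_carrier[OF M] M] c(1)
    by (rule mult_mat_vec_carrier)
  have w: "w \<in> carrier_vec m"
    using u c by (simp add: w_def)
  have "0 \<le> 2 * t * (vec_norm w)\<^sup>2 + t\<^sup>2 * ((vec_norm (M *\<^sub>v w))\<^sup>2 - s\<^sup>2 * (vec_norm w)\<^sup>2)" for t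
  proof -
    let ?d = "c + complex_of_real t \<cdot>\<^sub>v w"
    have d: "?d \<in> carrier_vec m"
      using c w by simp
    have Md: "M *\<^sub>v ?d = M *\<^sub>v c + complex_of_real t \<cdot>\<^sub>v (M *\<^sub>v w)"
      using M c w by (simp add: mult_add_distrib_mat_vec mult_mat_vec)
    \<comment> \<open>Minimality at the perturbed vector, squared so that both sides become
      quadratics in \<open>t\<close>. Both constant terms are s^2, as \<open>c\<close> is a unit
      vector, and they cancel.\<close>
    have "(s * vec_norm ?d)\<^sup>2 \<le> (vec_norm (M *\<^sub>v ?d))\<^sup>2"
      using min[OF d] by (intro power_mono) (auto simp: s_def)
    also have "(vec_norm (M *\<^sub>v ?d))\<^sup>2 = s\<^sup>2 + 2 * t * Re (u \<bullet>c w) + t\<^sup>2 * (vec_norm (M *\<^sub>v w))\<^sup>2"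
    proof -
      have "(M *\<^sub>v c) \<bullet>c (M *\<^sub>v w) = u \<bullet>c w"
        using assoc_mult_mat_vec[OF mat_adjoint_carrier[OF M] M c(1)]
          cscalar_prod_mult_mat_vec[OF M mult_mat_vec_carrier[OF M c(1)] w]
        by (simp only: u_def)
      then show ?thesis
        unfolding Md
        using vec_norm_add_smult_sq[OF mult_mat_vec_carrier[OF M c(1)] mult_mat_vec_carrier[OF M w]]
        by (simp add: s_def)
    qed
    finally have "s\<^sup>2 * (vec_norm ?d)\<^sup>2
        \<le> s\<^sup>2 + 2 * t * Re (u \<bullet>c w) + t\<^sup>2 * (vec_norm (M *\<^sub>v w))\<^sup>2"
      by (simp only: power_mult_distrib)
    also have "(vec_norm ?d)\<^sup>2 = 1 + 2 * t * Re (c \<bullet>c w) + t\<^sup>2 * (vec_norm w)\<^sup>2"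
      using vec_norm_add_smult_sq[OF c(1) w] c(2) by simp
    finally have "0 \<le> 2 * t * (Re (u \<bullet>c w) - s\<^sup>2 * Re (c \<bullet>c w))
        + t\<^sup>2 * ((vec_norm (M *\<^sub>v w))\<^sup>2 - s\<^sup>2 * (vec_norm w)\<^sup>2)"
      by (simp add: algebra_simps)
    moreover have "(vec_norm w)\<^sup>2 = Re (u \<bullet>c w) - s\<^sup>2 * Re (c \<bullet>c w)"
    proof -
      have "w \<bullet>c w = u \<bullet>c w + complex_of_real (- (s\<^sup>2)) * (c \<bullet>c w)"
        using c u w by (subst (1) w_def) (simp add: add_scalar_prod_distrib[of _ m])
      then have "complex_of_real ((vec_norm w)\<^sup>2) = u \<bullet>c w + complex_of_real (- (s\<^sup>2)) * (c \<bullet>c w)"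
        by (simp only: cscalar_prod_self)
      from arg_cong[OF this, of Re] show ?thesis
        by (simp del: of_real_power of_real_minus)
    qed
    ultimately show ?thesis
      by (simp only:)
  qed
  then have "(vec_norm w)\<^sup>2 = 0"
    by (rule quadratic_nonneg_imp_linear_zero)
  then have w0: "w = 0\<^sub>v m"
    using vec_norm_eq_0_iff[OF w] by simp
  have "u = complex_of_real (s\<^sup>2) \<cdot>\<^sub>v c"
  proof (rule eq_vecI)
    fix i assume i: "i < dim_vec (complex_of_real (s\<^sup>2) \<cdot>\<^sub>v c)"
    then have "w $ i = 0"
      using w0 c by simp
    then show "u $ i = (complex_of_real (s\<^sup>2) \<cdot>\<^sub>v c) $ i"
      using i c u by (simp add: w_def)
  qed (use u c in auto)
  moreover have "c \<noteq> 0\<^sub>v m"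
    using c vec_norm_eq_0_iff[OF c(1)] by auto
  ultimately have "eigenvector (mat_adjoint M * M) c (complex_of_real (s\<^sup>2))"
    using M c by (auto simp: eigenvector_def u_def mat_adjoint_def)
  then show ?thesis
    by (auto simp: singular_value_def eigenvalue_def s_def)
qed

text \<open>Squares of singular values are eigenvalues of one square matrix, hence finitely many,
  and squaring is injective on nonnegative reals. Finiteness is required for \<open>Min\<close> in
  \<open>sigma_min\<close> to denote a minimum.\<close>

lemma finite_singular_values:
  assumes M: "M \<in> carrier_mat n m"
  shows "finite {s. singular_value M s}"
proof -
  from card_finite_spectrum(1)[OF mult_carrier_mat[OF mat_adjoint_carrier[OF M] M]]
  have "finite ((\<lambda>s. complex_of_real (s\<^sup>2)) ` {s. singular_value M s})"
    by (rule rev_finite_subset) (auto simp: singular_value_def spectrum_def)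
  moreover have "inj_on (\<lambda>s. complex_of_real (s\<^sup>2)) {s. singular_value M s}"
    unfolding of_real_eq_iff inj_on_def by (auto simp: singular_value_def)
  ultimately show ?thesis
    by (rule finite_imageD)
qed

text \<open>The minimum of \<parallel>Mc\<parallel> over unit vectors is itself a singular value.
  Every singular value is a quotient \<parallel>Mv\<parallel> / \<parallel>v\<parallel> for a
  singular vector \<open>v\<close>, hence no smaller.\<close>

lemma sigma_min_variational:
  assumes M: "M \<in> carrier_mat n m" and m: "m > 0"
  obtains c where "c \<in> carrier_vec m" "vec_norm c = 1" "vec_norm (M *\<^sub>v c) = sigma_min M"
    "\<And>d. d \<in> carrier_vec m \<Longrightarrow> sigma_min M * vec_norm d \<le> vec_norm (M *\<^sub>v d)"
proof -
  from min_vec_norm_mult_mat_vec[OF M m] obtain c where c: "c \<in> carrier_vec m" "vec_norm c = 1"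
    and min: "\<And>d. d \<in> carrier_vec m \<Longrightarrow> vec_norm (M *\<^sub>v c) * vec_norm d \<le> vec_norm (M *\<^sub>v d)"
    by blast
  have "sigma_min M = vec_norm (M *\<^sub>v c)"
    unfolding sigma_min_def
  proof (rule Min_eqI[OF finite_singular_values[OF M]])
    show "vec_norm (M *\<^sub>v c) \<in> {s. singular_value M s}"
      using minimizer_singular_value[OF M c min] by simp
    fix t assume "t \<in> {s. singular_value M s}"
    then obtain v where v: "eigenvector (mat_adjoint M * M) v (complex_of_real (t\<^sup>2))" and t: "0 \<le> t"
      by (auto simp: singular_value_def eigenvalue_def)
    from right_singular_vector_norm[OF M v t] min[of v]
    show "vec_norm (M *\<^sub>v c) \<le> t"
      by (auto intro: mult_right_le_imp_le)
  qed
  with that c min show ?thesis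
    by simp
qed

section \<open>Orthonormal bases of spans\<close>

lemma index_gram:
  fixes M :: "complex Matrix.mat"
  assumes M: "M \<in> carrier_mat n m" and "i < m" "j < m"
  shows "(mat_adjoint M * M) $$ (i, j) = col M j \<bullet>c col M i"
proof -
  have "col M k \<in> carrier_vec n" if "k < m" for k
    using M by (simp add: col_def)
  then have "col M j \<bullet>c col M i = (\<Sum>k<n. col M j $ k * cnj (col M i $ k))"
    using assms by (intro cscalar_prod_sum)
  then show ?thesis
    using assms mat_adjoint_carrier[OF M]
    by (auto simp: scalar_prod_def atLeast0LessThan index_mat_adjoint[OF M] ac_simps intro!: sum.cong)
qed

text \<open>A maximal linearly independent subset works: an element of \<open>S\<close> outside its
  span could be added to it. Gram-Schmidt will be applied to such a family.\<close>

lemma exists_lin_indpt_spanning_subset: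
  fixes S :: "complex Matrix.vec set"
  assumes S: "S \<subseteq> carrier_vec n" and finS: "finite S"
  obtains U where "U \<subseteq> S" "module.lin_indpt class_ring (module_vec TYPE(complex) n) U"
    "cspan n U = cspan n S"
proof -
  interpret vec_space "TYPE(complex)" n .
  let ?P = "\<lambda>T. T \<subseteq> S \<and> lin_indpt T"
  have "finite T \<and> card T \<le> card S" if "?P T" for T
    using that Finite_Set.card_mono[OF finS] Finite_Set.finite_subset[OF _ finS] by simp
  moreover have "?P {}"
    by (simp add: lin_dep_def)
  ultimately obtain U where max: "maximal U ?P"
    using maximal_exists[of ?P "card S" "{}"] by meson
  then have U: "U \<subseteq> S" "lin_indpt U"
    by (auto simp: maximal_def)
  have "s \<in> span U" if s: "s \<in> S" for s
  proof (rule ccontr)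
    assume ns: "s \<notin> span U"
    have Uc: "U \<subseteq> carrier_vec n"
      using U S by blast
    then have "s \<notin> U"
      using ns span_mem[of U s] by auto
    moreover have "lin_indpt (insert s U)"
      using lin_dep_iff_in_span[of U s] Uc U(2) s S ns \<open>s \<notin> U\<close> by auto
    ultimately show False
      using max U s unfolding maximal_def by blast
  qed
  then have "span S \<subseteq> span U"
    using U S by (intro span_subsetI) auto
  then have "span U = span S"
    using span_is_monotone[OF U(1)] by blast
  with U that show ?thesis
    by blast
qed

lemma cspan_scaled_eq:
  assumes us: "set us \<subseteq> carrier_vec n" and a: "\<And>u. u \<in> set us \<Longrightarrow> a u \<noteq> 0"
  shows "cspan n ((\<lambda>u. a u \<cdot>\<^sub>v u) ` set us) = cspan n (set us)"
proof -
  interpret vec_space "TYPE(complex)" n .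
  let ?X = "(\<lambda>u. a u \<cdot>\<^sub>v u) ` set us"
  have X: "?X \<subseteq> carrier_vec n"
    using us by auto
  have "?X \<subseteq> span (set us)"
    using us span_mem[OF us] smult_in_span[OF us] by blast
  moreover have "u \<in> span ?X" if u: "u \<in> set us" for u
  proof -
    have "inverse (a u) \<cdot>\<^sub>v (a u \<cdot>\<^sub>v u) \<in> span ?X"
      using u X by (intro smult_in_span span_mem) auto
    then show ?thesis
      using a[OF u] by (simp add: smult_smult_assoc)
  qed
  ultimately show ?thesis
    using span_subsetI[of "set us" ?X] span_subsetI[of ?X "set us"] us X by blast
qed

text \<open>Dependent vectors are discarded, Gram-Schmidt makes the rest orthogonal, and rescaling
  makes them unit vectors. Existence guarantees that \<open>SOME\<close> in
  \<open>reduced_pseudospectrum\<close> selects a genuine orthonormal basis.\<close>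

lemma orthonormal_basis_mat_exists:
  assumes S: "S \<subseteq> carrier_vec n" and finS: "finite S"
  shows "\<exists>V. orthonormal_basis_mat n (cspan n S) V"
proof -
  interpret cof_vec_space n "TYPE(complex)" .
  obtain U where U: "U \<subseteq> S" "lin_indpt U" "span U = span S"
    by (rule exists_lin_indpt_spanning_subset[OF S finS])
  obtain ws where ws: "set ws = U" "distinct ws"
    using finite_distinct_list finite_subset[OF U(1) finS] by blast
  define us where "us = gram_schmidt n ws"
  have wsc: "set ws \<subseteq> carrier_vec n"
    using ws U S by blast
  have gs: "span (set us) = span U" "corthogonal us" "set us \<subseteq> carrier_vec n"
    using gram_schmidt_result[OF wsc ws(2) _ us_def] U(2) ws(1) by auto
  define a where "a u = complex_of_real (inverse (vec_norm u))" for u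
  define V where "V = mat_of_cols n (map (\<lambda>u. a u \<cdot>\<^sub>v u) us)"
  \<comment> \<open>\<open>corthogonal\<close> makes a product of two members vanish exactly when
    their indices differ, so the product of a member with itself is nonzero and normalization is
    possible.\<close>
  have norm: "vec_norm u \<noteq> 0" if "u \<in> set us" for u
  proof -
    from that obtain i where "i < length us" "us ! i = u"
      by (auto simp: in_set_conv_nth)
    then have "u \<bullet>c u \<noteq> 0"
      using corthogonalD[OF gs(2), of i i] by auto
    then show ?thesis
      by (simp add: cscalar_prod_self)
  qed
  have V: "V \<in> carrier_mat n (length us)"
    by (intro carrier_matI) (simp_all add: V_def)
  have col: "col V i = a (us ! i) \<cdot>\<^sub>v us ! i" if "i < length us" for i
    using that gs(3) by (auto simp: V_def dest: nth_mem intro!: col_mat_of_cols)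
  have "mat_adjoint V * V = 1\<^sub>m (length us)"
  proof (rule eq_matI)
    fix i j assume "i < dim_row (1\<^sub>m (length us) :: complex Matrix.mat)"
      "j < dim_col (1\<^sub>m (length us) :: complex Matrix.mat)"
    then have ij: "i < length us" "j < length us"
      by auto
    then have c: "us ! i \<in> carrier_vec n" "us ! j \<in> carrier_vec n"
      using gs(3) by auto
    have "(mat_adjoint V * V) $$ (i, j) = a (us ! j) * a (us ! i) * (us ! j \<bullet>c us ! i)"
      using c unfolding index_gram[OF V ij] col[OF ij(1)] col[OF ij(2)]
      by (simp add: conjugate_smult_vec a_def)
    also have "\<dots> = (if i = j then 1 else 0)"
      using corthogonalD[OF gs(2) ij(2,1)] norm[OF nth_mem[OF ij(1)]]
      by (auto simp: cscalar_prod_self a_def power2_eq_square field_simps)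
    finally show "(mat_adjoint V * V) $$ (i, j) = 1\<^sub>m (length us) $$ (i, j)"
      using ij by simp
  qed (use mult_carrier_mat[OF mat_adjoint_carrier[OF V] V] in auto)
  moreover have "set (cols V) = (\<lambda>u. a u \<cdot>\<^sub>v u) ` set us"
    using gs(3) unfolding V_def by (subst cols_mat_of_cols) auto
  then have "span (set (cols V)) = span S"
    using cspan_scaled_eq[OF gs(3), of a] norm gs(1) U(3) by (simp add: a_def)
  ultimately show ?thesis
    using V unfolding orthonormal_basis_mat_def by blast
qed

lemma cspan_cols:
  assumes V: "V \<in> carrier_mat n m"
  shows "cspan n (set (cols V)) = (\<lambda>c. V *\<^sub>v c) ` carrier_vec m"
proof -
  interpret vec_space "TYPE(complex)" n .
  show ?thesis
    using col_space_eq[OF V] V mult_mat_vec_carrier[OF V] by (auto simp: col_space_def)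
qed

section \<open>Compressed pseudospectra\<close>

text \<open>The sum of the moduli of all entries serves as \<open>C\<close>; this crude bound
  suffices to show that pseudospectra are bounded.\<close>

lemma vec_norm_mult_mat_vec_bound:
  assumes B: "B \<in> carrier_mat n m"
  obtains C where "\<And>w. w \<in> carrier_vec m \<Longrightarrow> vec_norm (B *\<^sub>v w) \<le> C * vec_norm w"
proof -
  have "vec_norm (B *\<^sub>v w) \<le> (\<Sum>j<n. \<Sum>i<m. cmod (B $$ (j, i))) * vec_norm w"
    if w: "w \<in> carrier_vec m" for w
  proof -
    have wi: "cmod (w $ i) \<le> vec_norm w" if "i < m" for i
      using w that by (auto simp: vec_norm_def intro: member_le_L2_set)
    have "vec_norm (B *\<^sub>v w) \<le> (\<Sum>j<n. cmod ((B *\<^sub>v w) $ j))"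
      using L2_set_le_sum_abs[of "\<lambda>j. cmod ((B *\<^sub>v w) $ j)" "{..<n}"] B by (simp add: vec_norm_def)
    also have "\<dots> \<le> (\<Sum>j<n. \<Sum>i<m. cmod (B $$ (j, i)) * vec_norm w)"
    proof (rule sum_mono)
      fix j assume j: "j \<in> {..<n}"
      then have "cmod ((B *\<^sub>v w) $ j) = cmod (\<Sum>i<m. B $$ (j, i) * w $ i)"
        using B w by (simp add: scalar_prod_def atLeast0LessThan)
      also have "\<dots> \<le> (\<Sum>i<m. cmod (B $$ (j, i)) * vec_norm w)"
        using wi by (intro sum_norm_le) (auto simp: norm_mult mult_left_mono)
      finally show "cmod ((B *\<^sub>v w) $ j) \<le> (\<Sum>i<m. cmod (B $$ (j, i)) * vec_norm w)" .
    qed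
    finally show ?thesis
      by (simp add: sum_distrib_right)
  qed
  with that show ?thesis
    by blast
qed

section \<open>Residuals on the subspace in place of singular values\<close>

lemma compression_mult_mat_vec:
  fixes B V :: "complex Matrix.mat"
  assumes B: "B \<in> carrier_mat n n" and V: "V \<in> carrier_mat n m" and c: "c \<in> carrier_vec m"
  shows "(B * V - z \<cdot>\<^sub>m V) *\<^sub>v c = B *\<^sub>v (V *\<^sub>v c) - z \<cdot>\<^sub>v (V *\<^sub>v c)"
proof -
  have "(B * V - z \<cdot>\<^sub>m V) *\<^sub>v c = (B * V) *\<^sub>v c - (z \<cdot>\<^sub>m V) *\<^sub>v c"
    using B V c by (intro minus_mult_distrib_mat_vec) auto
  also have "(z \<cdot>\<^sub>m V) *\<^sub>v c = z \<cdot>\<^sub>v (V *\<^sub>v c)"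
    using V c by (intro eq_vecI) auto
  finally show ?thesis
    using assoc_mult_mat_vec[OF B V c] by simp
qed

text \<open>\<open>V\<close> maps coordinates isometrically onto its column span, so the variational
  description of the smallest singular value becomes one about residuals Bw - zw of vectors
  \<open>w\<close> in the span.\<close>

lemma sigma_min_compression:
  assumes B: "B \<in> carrier_mat n n" and V: "V \<in> carrier_mat n m"
    and VV: "mat_adjoint V * V = 1\<^sub>m m" and m: "m > 0"
  obtains w where "w \<in> cspan n (set (cols V))" "vec_norm w = 1"
    "vec_norm (B *\<^sub>v w - z \<cdot>\<^sub>v w) = sigma_min (B * V - z \<cdot>\<^sub>m V)"
    "\<And>u. u \<in> cspan n (set (cols V)) \<Longrightarrow>
       sigma_min (B * V - z \<cdot>\<^sub>m V) * vec_norm u \<le> vec_norm (B *\<^sub>v u - z \<cdot>\<^sub>v u)"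
proof -
  have M: "B * V - z \<cdot>\<^sub>m V \<in> carrier_mat n m"
    using B V by auto
  show ?thesis
  proof (rule sigma_min_variational[OF M m])
    fix c assume "c \<in> carrier_vec m" "vec_norm c = 1"
      "vec_norm ((B * V - z \<cdot>\<^sub>m V) *\<^sub>v c) = sigma_min (B * V - z \<cdot>\<^sub>m V)"
      "\<And>d. d \<in> carrier_vec m \<Longrightarrow>
        sigma_min (B * V - z \<cdot>\<^sub>m V) * vec_norm d \<le> vec_norm ((B * V - z \<cdot>\<^sub>m V) *\<^sub>v d)"
    then show ?thesis
      using that[of "V *\<^sub>v c"]
      by (force simp: cspan_cols[OF V] compression_mult_mat_vec[OF B V] vec_norm_isometry[OF V VV])
  qed
qed

text \<open>A matrix without columns spans only the zero vector. This supplies the positivity of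
  \<open>m\<close> under which minimizers on the unit sphere exist.\<close>

lemma orthonormal_basis_mat_nontrivial:
  assumes V: "V \<in> carrier_mat n m" and u: "u \<in> cspan n (set (cols V))" "u \<noteq> 0\<^sub>v n"
  shows "m > 0"
proof (rule ccontr)
  assume "\<not> m > 0"
  then have "u = 0\<^sub>v n"
    using V u(1) by (auto simp: cspan_cols[OF V] scalar_prod_def intro!: eq_vecI)
  with u(2) show False ..
qed

text \<open>The right-hand side mentions only the span of the columns, which makes independence of
  the basis and monotonicity in the subspace evident.\<close>

lemma sigma_min_compression_le_iff:
  assumes B: "B \<in> carrier_mat n n" and V: "V \<in> carrier_mat n m"
    and VV: "mat_adjoint V * V = 1\<^sub>m m" and m: "m > 0"
  shows "sigma_min (B * V - z \<cdot>\<^sub>m V) \<le> \<epsilon> \<longleftrightarrow>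
    (\<exists>w\<in>cspan n (set (cols V)). vec_norm w > 0 \<and> vec_norm (B *\<^sub>v w - z \<cdot>\<^sub>v w) \<le> \<epsilon> * vec_norm w)"
    (is "?L \<longleftrightarrow> ?R")
proof (rule sigma_min_compression[OF assms, of z])
  fix w assume w: "w \<in> cspan n (set (cols V))" "vec_norm w = 1"
    "vec_norm (B *\<^sub>v w - z \<cdot>\<^sub>v w) = sigma_min (B * V - z \<cdot>\<^sub>m V)"
    and min: "\<And>u. u \<in> cspan n (set (cols V)) \<Longrightarrow>
       sigma_min (B * V - z \<cdot>\<^sub>m V) * vec_norm u \<le> vec_norm (B *\<^sub>v u - z \<cdot>\<^sub>v u)"
  show ?thesis
  proof
    assume ?L
    with w show ?R
      by (intro bexI[of _ w]) auto
  next
    assume ?R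
    with min show ?L
      by (meson mult_right_le_imp_le order_trans)
  qed
qed

text \<open>A unit vector \<open>w\<close> minimizing the residual at \<open>z\<close> is a test
  vector at \<open>y\<close>; the two residuals differ by (z - y)w, of norm |y - z|.\<close>

lemma sigma_min_compression_lipschitz:
  assumes B: "B \<in> carrier_mat n n" and V: "V \<in> carrier_mat n m"
    and VV: "mat_adjoint V * V = 1\<^sub>m m" and m: "m > 0"
  shows "sigma_min (B * V - y \<cdot>\<^sub>m V) \<le> sigma_min (B * V - z \<cdot>\<^sub>m V) + cmod (y - z)"
proof -
  obtain w where w: "w \<in> cspan n (set (cols V))" "vec_norm w = 1"
    "vec_norm (B *\<^sub>v w - z \<cdot>\<^sub>v w) = sigma_min (B * V - z \<cdot>\<^sub>m V)"
    using sigma_min_compression[OF assms] by metis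
  have wc: "w \<in> carrier_vec n"
    using w(1) V by (auto simp: cspan_cols[OF V])
  have Bw: "B *\<^sub>v w \<in> carrier_vec n"
    using B wc by simp
  have "B *\<^sub>v w - y \<cdot>\<^sub>v w = (B *\<^sub>v w - z \<cdot>\<^sub>v w) + (z - y) \<cdot>\<^sub>v w"
    using Bw wc B by (intro eq_vecI) (auto simp: algebra_simps)
  moreover have "sigma_min (B * V - y \<cdot>\<^sub>m V) * vec_norm w \<le> vec_norm (B *\<^sub>v w - y \<cdot>\<^sub>v w)"
    using sigma_min_compression[OF assms] w(1) by metis
  moreover have "vec_norm ((B *\<^sub>v w - z \<cdot>\<^sub>v w) + (z - y) \<cdot>\<^sub>v w)
      \<le> vec_norm (B *\<^sub>v w - z \<cdot>\<^sub>v w) + vec_norm ((z - y) \<cdot>\<^sub>v w)"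
    using Bw wc by (intro vec_norm_triangle[of _ n]) auto
  ultimately show ?thesis
    using w(2,3) by (simp add: vec_norm_smult norm_minus_commute)
qed

text \<open>Closedness comes from the Lipschitz bound in \<open>z\<close>. Boundedness comes from
  |z| = \<parallel>zw\<parallel> \<le> \<parallel>Bw\<parallel> + \<parallel>Bw - zw\<parallel>
  \<le> C + \<epsilon> at a minimizing unit vector \<open>w\<close>.\<close>

lemma compact_compression_pseudospectrum:
  assumes B: "B \<in> carrier_mat n n" and V: "V \<in> carrier_mat n m"
    and VV: "mat_adjoint V * V = 1\<^sub>m m" and m: "m > 0"
  shows "compact {z. sigma_min (B * V - z \<cdot>\<^sub>m V) \<le> \<epsilon>}"
proof -
  let ?s = "\<lambda>z. sigma_min (B * V - z \<cdot>\<^sub>m V)"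
  have "dist (?s y) (?s z) \<le> 1 * dist y z" for y z
    using sigma_min_compression_lipschitz[OF assms, of y z]
      sigma_min_compression_lipschitz[OF assms, of z y]
    by (simp add: dist_real_def dist_norm norm_minus_commute abs_le_iff)
  then have "1-lipschitz_on UNIV ?s"
    by (intro lipschitz_onI) auto
  then have "closed {z. ?s z \<le> \<epsilon>}"
    by (intro closed_Collect_le lipschitz_on_continuous_on continuous_on_const)
  moreover obtain C where C: "\<And>w. w \<in> carrier_vec n \<Longrightarrow> vec_norm (B *\<^sub>v w) \<le> C * vec_norm w"
    using vec_norm_mult_mat_vec_bound[OF B] by blast
  have "cmod z \<le> C + \<epsilon>" if z: "?s z \<le> \<epsilon>" for z
  proof -
    obtain w where w: "w \<in> cspan n (set (cols V))" "vec_norm w = 1"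
      "vec_norm (B *\<^sub>v w - z \<cdot>\<^sub>v w) = ?s z"
      using sigma_min_compression[OF assms] by metis
    have wc: "w \<in> carrier_vec n"
      using w(1) V by (auto simp: cspan_cols[OF V])
    have Bw: "B *\<^sub>v w \<in> carrier_vec n"
      using B wc by simp
    have "z \<cdot>\<^sub>v w = B *\<^sub>v w + (- 1) \<cdot>\<^sub>v (B *\<^sub>v w - z \<cdot>\<^sub>v w)"
      using Bw wc B by (intro eq_vecI) auto
    moreover have "vec_norm (B *\<^sub>v w + (- 1) \<cdot>\<^sub>v (B *\<^sub>v w - z \<cdot>\<^sub>v w))
        \<le> vec_norm (B *\<^sub>v w) + vec_norm ((- 1) \<cdot>\<^sub>v (B *\<^sub>v w - z \<cdot>\<^sub>v w))"
      using Bw wc by (intro vec_norm_triangle[of _ n]) auto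
    ultimately have "cmod z * vec_norm w \<le> vec_norm (B *\<^sub>v w) + ?s z"
      using w(3) by (metis vec_norm_smult norm_minus_cancel norm_one mult_1)
    with C[OF wc] w(2) z show ?thesis
      by simp
  qed
  then have "bounded {z. ?s z \<le> \<epsilon>}"
    by (auto simp: bounded_iff)
  ultimately show ?thesis
    by (simp add: compact_eq_bounded_closed)
qed

text \<open>Compactness yields a point of largest real part, so \<open>GREATEST\<close> in
  \<open>abscissa\<close> denotes an attained maximum and not an unspecified value.\<close>

lemma abscissa_attained:
  assumes S: "compact S" and ne: "S \<noteq> {}"
  shows "abscissa S \<in> Re ` S" and "z \<in> S \<Longrightarrow> Re z \<le> abscissa S"
proof -
  have "compact (Re ` S)"
    by (intro compact_continuous_image continuous_intros S)
  then obtain r where r: "r \<in> Re ` S" "\<And>t. t \<in> Re ` S \<Longrightarrow> t \<le> r"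
    using compact_attains_sup[of "Re ` S"] ne by auto
  then have "abscissa S = r"
    unfolding abscissa_def by (intro Greatest_equality) auto
  with r show "abscissa S \<in> Re ` S" and "z \<in> S \<Longrightarrow> Re z \<le> abscissa S"
    by auto
qed

text \<open>A description of pseudospectra free of basis matrices; with the subspace as an argument,
  full and reduced pseudospectra are compared through inclusions of subspaces.\<close>

definition has_pseudoeigenvector ::
    "real \<Rightarrow> complex Matrix.vec set \<Rightarrow> complex Matrix.mat \<Rightarrow> complex \<Rightarrow> bool" where
  "has_pseudoeigenvector \<epsilon> W B z \<longleftrightarrow>
     (\<exists>w\<in>W. vec_norm w > 0 \<and> vec_norm (B *\<^sub>v w - z \<cdot>\<^sub>v w) \<le> \<epsilon> * vec_norm w)"

text \<open>The selected basis disappears because the characterization depends only on its span. The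
  vector \<open>u\<close> rules out the zero subspace, whose basis matrix has no columns.\<close>

lemma reduced_pseudospectrum_eq_compact:
  assumes B: "B \<in> carrier_mat n n" and S: "S \<subseteq> carrier_vec n" "finite S"
    and u: "u \<in> S" "u \<noteq> 0\<^sub>v n"
  shows "reduced_pseudospectrum n \<epsilon> (cspan n S) B = {z. has_pseudoeigenvector \<epsilon> (cspan n S) B z}"
    and "compact (reduced_pseudospectrum n \<epsilon> (cspan n S) B)"
proof -
  interpret vec_space "TYPE(complex)" n .
  define V where "V = (SOME V. orthonormal_basis_mat n (cspan n S) V)"
  have "orthonormal_basis_mat n (cspan n S) V"
    unfolding V_def by (rule someI_ex[OF orthonormal_basis_mat_exists[OF S]])
  then obtain m where V: "V \<in> carrier_mat n m" "mat_adjoint V * V = 1\<^sub>m m"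
    and span: "cspan n (set (cols V)) = cspan n S"
    by (auto simp: orthonormal_basis_mat_def)
  have "u \<in> cspan n (set (cols V))"
    unfolding span using span_mem[of S u] S u by simp
  then have m: "m > 0"
    using orthonormal_basis_mat_nontrivial[OF V(1)] u(2) by blast
  have eq: "reduced_pseudospectrum n \<epsilon> (cspan n S) B = {z. sigma_min (B * V - z \<cdot>\<^sub>m V) \<le> \<epsilon>}"
    by (simp add: reduced_pseudospectrum_def V_def Let_def)
  show "compact (reduced_pseudospectrum n \<epsilon> (cspan n S) B)"
    unfolding eq by (rule compact_compression_pseudospectrum[OF B V m])
  show "reduced_pseudospectrum n \<epsilon> (cspan n S) B = {z. has_pseudoeigenvector \<epsilon> (cspan n S) B z}"
    unfolding eq sigma_min_compression_le_iff[OF B V m] span has_pseudoeigenvector_def ..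
qed

text \<open>The identity is an orthonormal basis matrix of the whole space, so this is the case of
  the compression results with \<open>V\<close> the identity.\<close>

lemma pseudospectrum_eq_compact:
  assumes B: "B \<in> carrier_mat n n" and n: "n > 0"
  shows "pseudospectrum n \<epsilon> B = {z. has_pseudoeigenvector \<epsilon> (carrier_vec n) B z}"
    and "compact (pseudospectrum n \<epsilon> B)"
proof -
  have V: "1\<^sub>m n \<in> carrier_mat n n" "mat_adjoint (1\<^sub>m n) * 1\<^sub>m n = (1\<^sub>m n :: complex Matrix.mat)"
  proof -
    have "mat_adjoint (1\<^sub>m n) = (1\<^sub>m n :: complex Matrix.mat)"
      using mat_adjoint_carrier[of "1\<^sub>m n :: complex Matrix.mat" n n]
      by (intro eq_matI) (auto simp: index_mat_adjoint[of _ n n])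
    then show "mat_adjoint (1\<^sub>m n) * 1\<^sub>m n = (1\<^sub>m n :: complex Matrix.mat)"
      by simp
  qed simp
  have "cspan n (set (cols (1\<^sub>m n))) = (carrier_vec n :: complex Matrix.vec set)"
    by (auto simp: cspan_cols[OF V(1)] image_iff)
  then show "pseudospectrum n \<epsilon> B = {z. has_pseudoeigenvector \<epsilon> (carrier_vec n) B z}"
    using sigma_min_compression_le_iff[OF B V n] B
    by (simp add: pseudospectrum_def has_pseudoeigenvector_def)
  show "compact (pseudospectrum n \<epsilon> B)"
    using compact_compression_pseudospectrum[OF B V n] B by (simp add: pseudospectrum_def)
qed

lemma has_pseudoeigenvector_mono:
  "W \<subseteq> W' \<Longrightarrow> has_pseudoeigenvector \<epsilon> W B z \<Longrightarrow> has_pseudoeigenvector \<epsilon> W' B z"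
  by (auto simp: has_pseudoeigenvector_def)

text \<open>The singular vector is the witness: its residual is \<open>sigma_min\<close> times its
  norm. Every subspace containing \<open>v\<close> therefore retains \<open>z\<close>, which is the
  interpolation property of the framework.\<close>

lemma has_pseudoeigenvector_rightmost:
  assumes B: "B \<in> carrier_mat n n" and n: "n > 0"
    and z: "rightmost (pseudospectrum n \<epsilon> B) z"
    and v: "right_singular_vector (B - z \<cdot>\<^sub>m 1\<^sub>m n) (sigma_min (B - z \<cdot>\<^sub>m 1\<^sub>m n)) v"
    and W: "v \<in> W"
  shows "has_pseudoeigenvector \<epsilon> W B z"
proof -
  let ?M = "B - z \<cdot>\<^sub>m 1\<^sub>m n"
  have M: "?M \<in> carrier_mat n n"
    by (intro minus_carrier_mat) simp
  have s: "0 \<le> sigma_min ?M" "eigenvector (mat_adjoint ?M * ?M) v (complex_of_real ((sigma_min ?M)\<^sup>2))"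
    using v by (auto simp: right_singular_vector_def singular_value_def)
  note * = right_singular_vector_norm[OF M s(2) s(1)]
  have "?M *\<^sub>v v = B *\<^sub>v v - z \<cdot>\<^sub>v v"
    using compression_mult_mat_vec[OF B one_carrier_mat *(1), of z] B *(1) by simp
  moreover have "sigma_min ?M \<le> \<epsilon>"
    using z by (auto simp: rightmost_def is_arg_max_def pseudospectrum_def)
  ultimately show ?thesis
    using * W by (auto simp: has_pseudoeigenvector_def intro!: bexI[of _ v] mult_right_mono)
qed

lemma abscissa_rightmost:
  assumes "compact S" "rightmost S z"
  shows "abscissa S = Re z"
proof -
  from assms(2) have z: "z \<in> S" "\<And>y. y \<in> S \<Longrightarrow> Re y \<le> Re z"
    by (auto simp: rightmost_def is_arg_max_linorder)
  then show ?thesis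
    unfolding abscissa_def by (intro Greatest_equality) auto
qed

text \<open>The maximum over \<open>S\<close> is attained at a point that also lies in
  \<open>T\<close>; nonemptiness of \<open>S\<close> ensures that there is such a maximum.\<close>

lemma abscissa_mono:
  assumes "compact S" "compact T" "S \<subseteq> T" "S \<noteq> {}"
  shows "abscissa S \<le> abscissa T"
proof -
  obtain z where "z \<in> S" "abscissa S = Re z"
    using abscissa_attained(1)[OF assms(1,4)] by auto
  then show ?thesis
    using abscissa_attained(2)[OF assms(2)] assms(3) by (metis empty_iff subsetD)
qed

section \<open>The subspace framework\<close>

lemma cspan_sum_singleton:
  assumes "S \<subseteq> carrier_vec n" "v \<in> carrier_vec n"
  shows "{a + b | a b. a \<in> cspan n S \<and> b \<in> cspan n {v}} = cspan n (insert v S)"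
proof -
  interpret vec_space "TYPE(complex)" n .
  have "span (S \<union> {v}) = submodule_sum (span S) (span {v})"
    using assms by (intro span_union_is_sum) auto
  then show ?thesis
    by (auto simp: submodule_sum_def image_iff)
qed

text \<open>Unfolding the recursion gives a finite spanning set of singular vectors, from which
  orthonormal bases and inclusions between the subspaces follow. For \<open>j = 1\<close> the range
  \<open>{2..j}\<close> is empty.\<close>

lemma subspace_framework_span:
  assumes run: "subspace_framework n \<epsilon> B K \<eta> x1 z1 v1 x z v W"
    and B: "\<And>y. B y \<in> carrier_mat n n" and j: "1 \<le> j"
  shows "v1 ` {1..\<eta>} \<union> v ` {2..j} \<subseteq> carrier_vec n"
    and "W j = cspan n (v1 ` {1..\<eta>} \<union> v ` {2..j})"
proof -
  have carrier: "u \<in> carrier_vec n"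
    if "right_singular_vector (B y - s \<cdot>\<^sub>m 1\<^sub>m n) t u" for y s t u
  proof -
    have "B y - s \<cdot>\<^sub>m 1\<^sub>m n \<in> carrier_mat n n"
      by (intro minus_carrier_mat) simp
    from right_singular_vector_norm(1)[OF this, of u t] that show ?thesis
      by (auto simp: right_singular_vector_def singular_value_def)
  qed
  have v1: "v1 i \<in> carrier_vec n" if "i \<in> {1..\<eta>}" for i
    using run that unfolding subspace_framework_def by (blast intro: carrier)
  have v: "v i \<in> carrier_vec n" if "2 \<le> i" for i
    using run that unfolding subspace_framework_def by (blast intro: carrier)
  have sub: "v1 ` {1..\<eta>} \<union> v ` {2..i} \<subseteq> carrier_vec n" for i
    using v1 v by auto
  then show "v1 ` {1..\<eta>} \<union> v ` {2..j} \<subseteq> carrier_vec n" .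
  show "W j = cspan n (v1 ` {1..\<eta>} \<union> v ` {2..j})"
    using j
  proof (induction j rule: dec_induct)
    case base
    show ?case
      using run by (simp add: subspace_framework_def)
  next
    case (step i)
    have "2 \<le> Suc i \<Longrightarrow>
        W (Suc i) = {a + b | a b. a \<in> W (Suc i - 1) \<and> b \<in> cspan n {v (Suc i)}}"
      using run unfolding subspace_framework_def by blast
    then have "W (Suc i) = {a + b | a b. a \<in> W i \<and> b \<in> cspan n {v (Suc i)}}"
      using step.hyps by simp
    also have "\<dots> = cspan n (insert (v (Suc i)) (v1 ` {1..\<eta>} \<union> v ` {2..i}))"
      unfolding step.IH using step.hyps by (intro cspan_sum_singleton sub v) auto
    also have "insert (v (Suc i)) (v1 ` {1..\<eta>} \<union> v ` {2..i}) = v1 ` {1..\<eta>} \<union> v ` {2..Suc i}"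
      using step.hyps by (auto simp: atLeastAtMostSuc_conv)
    finally show ?case .
  qed
qed

theorem theorem3p1:
  fixes \<Omega> K :: "(real ^ 'd) set"
    and n \<kappa> \<eta> :: nat
    and f :: "nat \<Rightarrow> real ^ 'd \<Rightarrow> real"
    and A :: "nat \<Rightarrow> complex Matrix.mat"
    and \<epsilon> :: real
    and x1 x :: "nat \<Rightarrow> real ^ 'd"
    and z1 z :: "nat \<Rightarrow> complex"
    and v1 v :: "nat \<Rightarrow> complex Matrix.vec"
    and W :: "nat \<Rightarrow> complex Matrix.vec set"
  defines "B \<equiv> matrix_family n \<kappa> f A"
  assumes "n \<ge> 1"
    and "\<Omega> \<noteq> {}" and "open \<Omega>"
    and "K \<subseteq> \<Omega>" and "compact K" and "convex K" and "interior K \<noteq> {}"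
    and "\<And>l. l \<in> {1..\<kappa>} \<Longrightarrow> real_analytic_on (f l) \<Omega>"
    and "\<And>l. l \<in> {1..\<kappa>} \<Longrightarrow> A l \<in> carrier_mat n n"
    and "\<epsilon> > 0"
    and "\<eta> \<ge> 1"
    and "subspace_framework n \<epsilon> B K \<eta> x1 z1 v1 x z v W"
    and "\<And>y. y \<in> K \<Longrightarrow> reduced_pseudospectrum n \<epsilon> (W 1) (B y) \<noteq> {}"
    and "2 \<le> l" and "l < k" and "x l = x k"
  shows "is_arg_min (\<lambda>y. abscissa (pseudospectrum n \<epsilon> (B y))) (\<lambda>y. y \<in> K) (x l)"
proof -
  note run = \<open>subspace_framework n \<epsilon> B K \<eta> x1 z1 v1 x z v W\<close>
  have n: "n > 0"
    using \<open>n \<ge> 1\<close> by simp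
  have B: "B y \<in> carrier_mat n n" for y
    by (simp add: B_def matrix_family_def)
  define S where "S j = v1 ` {1..\<eta>} \<union> v ` {2..j}" for j
  define \<Lambda> where "\<Lambda> j y = reduced_pseudospectrum n \<epsilon> (W j) (B y)" for j y
  have W: "W j = cspan n (S j)" and S: "S j \<subseteq> carrier_vec n" "finite (S j)" if "1 \<le> j" for j
    using subspace_framework_span[OF run B that] by (simp_all add: S_def)
  interpret vec_space "TYPE(complex)" n .
  \<comment> \<open>An eigenvector is nonzero, so the first vector of the initial step, present
    because \<open>\<eta> \<ge> 1\<close>, keeps every \<open>W j\<close> from being the zero
    subspace.\<close>
  have "right_singular_vector (B (x1 1) - z1 1 \<cdot>\<^sub>m 1\<^sub>m n)
      (sigma_min (B (x1 1) - z1 1 \<cdot>\<^sub>m 1\<^sub>m n)) (v1 1)"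
    using run \<open>\<eta> \<ge> 1\<close> by (simp add: subspace_framework_def)
  then have v1_nz: "v1 1 \<noteq> 0\<^sub>v n"
    using B[of "x1 1"] by (auto simp: right_singular_vector_def eigenvector_def mat_adjoint_def)
  have v1_in: "v1 1 \<in> S j" for j
    using \<open>\<eta> \<ge> 1\<close> by (simp add: S_def)
  have \<Lambda>: "\<Lambda> j y = {z. has_pseudoeigenvector \<epsilon> (W j) (B y) z}" "compact (\<Lambda> j y)"
    if "1 \<le> j" for j y
    using reduced_pseudospectrum_eq_compact[OF B S[OF that] v1_in v1_nz] by (simp_all add: \<Lambda>_def W[OF that])
  have W_mono: "W i \<subseteq> W j" if "1 \<le> i" "i \<le> j" for i j
  proof -
    have "S i \<subseteq> S j"
      using that by (auto simp: S_def)
    then show ?thesis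
      using that W[of i] W[of j] span_is_monotone by simp
  qed
  have W_carrier: "W j \<subseteq> carrier_vec n" if "1 \<le> j" for j
    using W[OF that] S[OF that] span_is_subset2 by simp
  have mono: "abscissa (\<Lambda> j y) \<le> abscissa (pseudospectrum n \<epsilon> (B y))"
    if "y \<in> K" "1 \<le> j" for j y
  proof (rule abscissa_mono)
    show "compact (\<Lambda> j y)" "compact (pseudospectrum n \<epsilon> (B y))"
      using \<Lambda>(2) that pseudospectrum_eq_compact(2)[OF B n] by auto
    show "\<Lambda> j y \<subseteq> pseudospectrum n \<epsilon> (B y)"
      unfolding \<Lambda>(1)[OF that(2)] pseudospectrum_eq_compact(1)[OF B n]
      using has_pseudoeigenvector_mono[OF W_carrier[OF that(2)]] by blast
    \<comment> \<open>Nonemptiness is assumed for the first subspace; growth of the subspaces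
      carries it to all later ones.\<close>
    have "\<Lambda> 1 y \<subseteq> \<Lambda> j y"
      unfolding \<Lambda>(1)[OF that(2)] \<Lambda>(1)[OF order_refl]
      using has_pseudoeigenvector_mono[OF W_mono[OF order_refl that(2)]] by blast
    moreover have "\<Lambda> 1 y \<noteq> {}"
      using assms that(1) by (simp add: \<Lambda>_def)
    ultimately show "\<Lambda> j y \<noteq> {}"
      by blast
  qed
  have l: "x l \<in> K" "rightmost (pseudospectrum n \<epsilon> (B (x l))) (z l)"
    "right_singular_vector (B (x l) - z l \<cdot>\<^sub>m 1\<^sub>m n) (sigma_min (B (x l) - z l \<cdot>\<^sub>m 1\<^sub>m n)) (v l)"
    using run \<open>2 \<le> l\<close> by (auto simp: subspace_framework_def is_arg_min_def)
  have k1: "1 \<le> k - 1"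
    using \<open>2 \<le> l\<close> \<open>l < k\<close> by simp
  \<comment> \<open>Here \<open>l < k\<close> enters: \<open>l\<close> is at most
    \<open>k - 1\<close>, so the vector from step \<open>l\<close> already belongs to the subspace
    that defines the objective of step \<open>k\<close>.\<close>
  have "v l \<in> S (k - 1)"
    using \<open>2 \<le> l\<close> \<open>l < k\<close> by (auto simp: S_def)
  then have "v l \<in> W (k - 1)"
    using W[OF k1] S[OF k1] span_mem by simp
  then have "z l \<in> \<Lambda> (k - 1) (x l)"
    unfolding \<Lambda>(1)[OF k1] using has_pseudoeigenvector_rightmost[OF B n l(2,3)] by simp
  then have "Re (z l) \<le> abscissa (\<Lambda> (k - 1) (x l))"
    using abscissa_attained(2)[OF \<Lambda>(2)[OF k1]] by blast
  then have interp: "abscissa (pseudospectrum n \<epsilon> (B (x l))) \<le> abscissa (\<Lambda> (k - 1) (x l))"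
    using abscissa_rightmost[OF pseudospectrum_eq_compact(2)[OF B n] l(2)] by simp
  \<comment> \<open>The equality \<open>x l = x k\<close> transfers the optimality of
    \<open>x k\<close> to \<open>x l\<close>, the point where the objective of step \<open>k\<close>
    agrees with the full abscissa.\<close>
  have "2 \<le> k \<Longrightarrow> is_arg_min (\<lambda>y. abscissa (\<Lambda> (k - 1) y)) (\<lambda>y. y \<in> K) (x k)"
    using run unfolding subspace_framework_def \<Lambda>_def by blast
  then have "is_arg_min (\<lambda>y. abscissa (\<Lambda> (k - 1) y)) (\<lambda>y. y \<in> K) (x l)"
    using \<open>2 \<le> l\<close> \<open>l < k\<close> \<open>x l = x k\<close> by simp
  then have opt: "abscissa (\<Lambda> (k - 1) (x l)) \<le> abscissa (\<Lambda> (k - 1) y)" if "y \<in> K" for y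
    using that by (simp add: is_arg_min_linorder)
  show ?thesis
    unfolding is_arg_min_linorder
  proof (intro conjI allI impI)
    fix y assume "y \<in> K"
    \<comment> \<open>The chain is: full abscissa at \<open>x l\<close> \<le> reduced at
      \<open>x l\<close> \<le> reduced at \<open>y\<close> \<le> full at \<open>y\<close>.\<close>
    from interp opt[OF this] mono[OF this k1]
    show "abscissa (pseudospectrum n \<epsilon> (B (x l))) \<le> abscissa (pseudospectrum n \<epsilon> (B y))"
      by linarith
  qed (rule l(1))
qed

end
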